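(* Let $\Gamma\vdash A$ be a sequent of Constructive Natural Deduction such that $\Gamma$ contains atomic propositions only. If $\Gamma\vdash A$ has a specific-cut-free proof in Constructive Natural Deduction, then $\Gamma\vdash f(A)$ has a proof in the pseudo-automaton $\mathcal{A}$, and for each leaf $\Delta\vdash B$ of this proof that is proved with the delay rule, the sequent $u(\Delta)\vdash u(B)$ has a proof in Constructive Natural Deduction.
   Context: Propositions are first-order formulas built from atomic propositions $P(t_1,\dots,t_k)$ ($P$ a predicate symbol; $\top$ and $\bot$ are not atomic), $\top$, $\bot$, $\wedge$, $\vee$, $\Rightarrow$, $\forall$, $\exists$. Sequents are $\Gamma\vdash A$ with $\Gamma$ a finite list of propositions. Constructive Natural Deduction has the introduction rules: axiom $\Gamma,A\vdash A$; $\top$-intro $\Gamma\vdash\top$; $\wedge$-intro (from $\Gamma\vdash A$, $\Gamma\vdash B$ infer $\Gamma\vdash A\wedge B$); $\vee$-intro (from $\Gamma\vdash A$, or from $\Gamma\vdash B$, infer $\Gamma\vdash A\vee B$); $\Rightarrow$-intro (from $\Gamma,A\vdash B$ infer $\Gamma\vdash A\Rightarrow B$); $\forall$-intro (from $\Gamma\vdash A$ infer $\Gamma\vdash\forall x\,A$, $x$ not free in $\Gamma$); $\exists$-intro (from $\Gamma\vdash(t/x)A$ infer $\Gamma\vdash\exists x\,A$); and the elimination rules, whose leftmost premise is the major one: $\bot$-elim (from $\Gamma\vdash\bot$ infer $\Gamma\vdash A$); $\wedge$-elim (from $\Gamma\vdash A\wedge B$ infer $\Gamma\vdash A$, or $\Gamma\vdash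 B$); $\vee$-elim (from $\Gamma\vdash A\vee B$, $\Gamma,A\vdash C$, $\Gamma,B\vdash C$ infer $\Gamma\vdash C$); $\Rightarrow$-elim (from $\Gamma\vdash A\Rightarrow B$, $\Gamma\vdash A$ infer $\Gamma\vdash B$); $\forall$-elim (from $\Gamma\vdash\forall x\,A$ infer $\Gamma\vdash(t/x)A$); $\exists$-elim (from $\Gamma\vdash\exists x\,A$, $\Gamma,A\vdash B$ infer $\Gamma\vdash B$, $x$ not free in $\Gamma,B$). A specific cut is a proof whose last rule is $\wedge$-elim, $\vee$-elim, $\Rightarrow$-elim, $\forall$-elim or $\exists$-elim, whose major premise is proved by a proof ending with $\wedge$-intro, $\vee$-intro, $\Rightarrow$-intro, $\forall$-intro or $\exists$-intro respectively; a proof is specific-cut-free if none of its sub-proofs is a specific cut. Introduce a unary modality $[\cdot]$, allowing expressions $[A]$ as propositions. The freeze function $f$: $f(A\Rightarrow B)=[A]\Rightarrow f(B)$ if $A$ is not atomic; $f(P\Rightarrow B)=P\Rightarrow f(B)$ if $P$ is atomic; $f(P)=P$ for $P$ atomic; $f(\top)=\top$, $f(\bot)=\bot$; $f(A\wedge B)=f(A)\wedge f(B)$, $f(A\vee B)=f(A)\vee f(B)$, $f(\forall x\,A)=\forall x\,f(A)$, $f(\exists x\,A)=\exists x\,f(A)$. The unfreeze function $u$: $u([A])=u(A)$, $u(P)=P$ for atomic $P$, $u(\top)=\top$, $u(\bot)=\bot$, and $u$ commutes with $\Rightarrow,\wedge,\vee,\forall,\exists$; it is extended to lists of propositions componentwise.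 The pseudo-automaton $\mathcal{A}$ is the inference system (on sequents possibly containing $[\cdot]$) formed by the introduction rules of Constructive Natural Deduction listed above (including the axiom rule) together with the delay rule, which has no premises and conclusion $\Gamma,[A]\vdash B$ (for any $\Gamma$, $A$, $B$). *)

theory Defs
  imports Main
begin

text \<open>Bound variables are de Bruijn indices, so propositions are identified up to renaming of bound
  variables. The modality \<open>[A]\<close> is the constructor \<open>Box\<close>; the propositions of Constructive Natural
  Deduction are the \<open>Box\<close>-free ones.\<close>

datatype 'f tm = Var nat | Fun 'f "'f tm list"

datatype ('f, 'p) fm =
    Pred 'p "'f tm list"
  | Top
  | Bot
  | And "('f, 'p) fm" "('f, 'p) fm"
  | Or "('f, 'p) fm" "('f, 'p) fm"
  | Imp "('f, 'p) fm" "('f, 'p) fm"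
  | Forall "('f, 'p) fm"
  | Exists "('f, 'p) fm"
  | Box "('f, 'p) fm"

fun atomic :: "('f, 'p) fm \<Rightarrow> bool" where
  "atomic (Pred p ts) = True"
| "atomic _ = False"

text \<open>A signature is given by a set \<open>F\<close> of function symbols and a set \<open>P\<close> of predicate symbols, each
  paired with its arity.\<close>

fun wf_tm :: "('f \<times> nat) set \<Rightarrow> 'f tm \<Rightarrow> bool" where
  "wf_tm F (Var n) = True"
| "wf_tm F (Fun g ts) = ((g, length ts) \<in> F \<and> (\<forall>t\<in>set ts. wf_tm F t))"

primrec wf_fm :: "('f \<times> nat) set \<Rightarrow> ('p \<times> nat) set \<Rightarrow> ('f, 'p) fm \<Rightarrow> bool" where
  "wf_fm F P (Pred p ts) = ((p, length ts) \<in> P \<and> (\<forall>t\<in>set ts. wf_tm F t))"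
| "wf_fm F P Top = True"
| "wf_fm F P Bot = True"
| "wf_fm F P (And A B) = (wf_fm F P A \<and> wf_fm F P B)"
| "wf_fm F P (Or A B) = (wf_fm F P A \<and> wf_fm F P B)"
| "wf_fm F P (Imp A B) = (wf_fm F P A \<and> wf_fm F P B)"
| "wf_fm F P (Forall A) = wf_fm F P A"
| "wf_fm F P (Exists A) = wf_fm F P A"
| "wf_fm F P (Box A) = wf_fm F P A"

primrec box_free :: "('f, 'p) fm \<Rightarrow> bool" where
  "box_free (Pred p ts) = True"
| "box_free Top = True"
| "box_free Bot = True"
| "box_free (And A B) = (box_free A \<and> box_free B)"
| "box_free (Or A B) = (box_free A \<and> box_free B)"
| "box_free (Imp A B) = (box_free A \<and> box_free B)"
| "box_free (Forall A) = box_free A"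
| "box_free (Exists A) = box_free A"
| "box_free (Box A) = False"

definition nd_fm :: "('f \<times> nat) set \<Rightarrow> ('p \<times> nat) set \<Rightarrow> ('f, 'p) fm \<Rightarrow> bool" where
  "nd_fm F P A \<longleftrightarrow> wf_fm F P A \<and> box_free A"

primrec subst_tm :: "(nat \<Rightarrow> 'f tm) \<Rightarrow> 'f tm \<Rightarrow> 'f tm" where
  "subst_tm \<sigma> (Var n) = \<sigma> n"
| "subst_tm \<sigma> (Fun g ts) = Fun g (map (subst_tm \<sigma>) ts)"

definition up :: "(nat \<Rightarrow> 'f tm) \<Rightarrow> nat \<Rightarrow> 'f tm" where
  "up \<sigma> = case_nat (Var 0) (\<lambda>n. subst_tm (\<lambda>k. Var (Suc k)) (\<sigma> n))"

primrec subst_fm :: "(nat \<Rightarrow> 'f tm) \<Rightarrow> ('f, 'p) fm \<Rightarrow> ('f, 'p) fm" where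
  "subst_fm \<sigma> (Pred p ts) = Pred p (map (subst_tm \<sigma>) ts)"
| "subst_fm \<sigma> Top = Top"
| "subst_fm \<sigma> Bot = Bot"
| "subst_fm \<sigma> (And A B) = And (subst_fm \<sigma> A) (subst_fm \<sigma> B)"
| "subst_fm \<sigma> (Or A B) = Or (subst_fm \<sigma> A) (subst_fm \<sigma> B)"
| "subst_fm \<sigma> (Imp A B) = Imp (subst_fm \<sigma> A) (subst_fm \<sigma> B)"
| "subst_fm \<sigma> (Forall A) = Forall (subst_fm (up \<sigma>) A)"
| "subst_fm \<sigma> (Exists A) = Exists (subst_fm (up \<sigma>) A)"
| "subst_fm \<sigma> (Box A) = Box (subst_fm \<sigma> A)"

text \<open>\<open>inst t A\<close> is \<open>(t/x)A\<close>, where \<open>x\<close> is the variable with index 0, bound in \<open>Forall A\<close> and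
  \<open>Exists A\<close>. The propositions in which that variable is not free are those of the form
  \<open>shift A\<close>: the side condition ``\<open>x\<close> not free in \<open>\<Gamma>\<close>'' is expressed by a premise with
  context \<open>map shift \<Gamma>\<close>.\<close>

definition inst :: "'f tm \<Rightarrow> ('f, 'p) fm \<Rightarrow> ('f, 'p) fm" where
  "inst t = subst_fm (case_nat t Var)"

definition shift :: "('f, 'p) fm \<Rightarrow> ('f, 'p) fm" where
  "shift = subst_fm (\<lambda>k. Var (Suc k))"

datatype ('f, 'p) sequent = Sequent "('f, 'p) fm list" "('f, 'p) fm"  (infix \<open>\<turnstile>\<close> 60)

datatype rule =
    Axiom | TopI | AndI | OrI1 | OrI2 | ImpI | ForallI | ExistsI
  | BotE | AndE1 | AndE2 | OrE | ImpE | ForallE | ExistsE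
  | Delay

text \<open>Rules relate a list of premises to a conclusion. There being no structural rules, the order of
  the context is immaterial: \<open>\<Gamma>, A\<close> is written \<open>A # \<Gamma>\<close> in premises, and a conclusion with context
  \<open>\<Gamma>, A\<close> is any sequent whose context has \<open>A\<close> as a member.\<close>

inductive intro_rule :: "rule \<Rightarrow> ('f, 'p) sequent list \<Rightarrow> ('f, 'p) sequent \<Rightarrow> bool" where
  "A \<in> set \<Gamma> \<Longrightarrow> intro_rule Axiom [] (\<Gamma> \<turnstile> A)"
| "intro_rule TopI [] (\<Gamma> \<turnstile> Top)"
| "intro_rule AndI [\<Gamma> \<turnstile> A, \<Gamma> \<turnstile> B] (\<Gamma> \<turnstile> And A B)"
| "intro_rule OrI1 [\<Gamma> \<turnstile> A] (\<Gamma> \<turnstile> Or A B)"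
| "intro_rule OrI2 [\<Gamma> \<turnstile> B] (\<Gamma> \<turnstile> Or A B)"
| "intro_rule ImpI [A # \<Gamma> \<turnstile> B] (\<Gamma> \<turnstile> Imp A B)"
| "intro_rule ForallI [map shift \<Gamma> \<turnstile> A] (\<Gamma> \<turnstile> Forall A)"
| "intro_rule ExistsI [\<Gamma> \<turnstile> inst t A] (\<Gamma> \<turnstile> Exists A)"

inductive elim_rule :: "rule \<Rightarrow> ('f, 'p) sequent list \<Rightarrow> ('f, 'p) sequent \<Rightarrow> bool" where
  "elim_rule BotE [\<Gamma> \<turnstile> Bot] (\<Gamma> \<turnstile> A)"
| "elim_rule AndE1 [\<Gamma> \<turnstile> And A B] (\<Gamma> \<turnstile> A)"
| "elim_rule AndE2 [\<Gamma> \<turnstile> And A B] (\<Gamma> \<turnstile> B)"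
| "elim_rule OrE [\<Gamma> \<turnstile> Or A B, A # \<Gamma> \<turnstile> C, B # \<Gamma> \<turnstile> C] (\<Gamma> \<turnstile> C)"
| "elim_rule ImpE [\<Gamma> \<turnstile> Imp A B, \<Gamma> \<turnstile> A] (\<Gamma> \<turnstile> B)"
| "elim_rule ForallE [\<Gamma> \<turnstile> Forall A] (\<Gamma> \<turnstile> inst t A)"
| "elim_rule ExistsE [\<Gamma> \<turnstile> Exists A, A # map shift \<Gamma> \<turnstile> shift B] (\<Gamma> \<turnstile> B)"

inductive delay_rule :: "rule \<Rightarrow> ('f, 'p) sequent list \<Rightarrow> ('f, 'p) sequent \<Rightarrow> bool" where
  "Box A \<in> set \<Gamma> \<Longrightarrow> delay_rule Delay [] (\<Gamma> \<turnstile> B)"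

text \<open>The prefix \<open>nd\<close> refers to Constructive Natural Deduction, \<open>pa\<close> to the pseudo-automaton.\<close>

definition nd_rule :: "rule \<Rightarrow> ('f, 'p) sequent list \<Rightarrow> ('f, 'p) sequent \<Rightarrow> bool" where
  "nd_rule r ps s \<longleftrightarrow> intro_rule r ps s \<or> elim_rule r ps s"

definition pa_rule :: "rule \<Rightarrow> ('f, 'p) sequent list \<Rightarrow> ('f, 'p) sequent \<Rightarrow> bool" where
  "pa_rule r ps s \<longleftrightarrow> intro_rule r ps s \<or> delay_rule r ps s"

datatype ('f, 'p) deriv = Infer (last_rule: rule) (concl: "('f, 'p) sequent") "('f, 'p) deriv list"

fun over :: "(('f, 'p) fm \<Rightarrow> bool) \<Rightarrow> ('f, 'p) sequent \<Rightarrow> bool" where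
  "over L (\<Gamma> \<turnstile> A) = ((\<forall>B\<in>set \<Gamma>. L B) \<and> L A)"

fun proof_in ::
  "(rule \<Rightarrow> ('f, 'p) sequent list \<Rightarrow> ('f, 'p) sequent \<Rightarrow> bool) \<Rightarrow> (('f, 'p) fm \<Rightarrow> bool) \<Rightarrow>
    ('f, 'p) deriv \<Rightarrow> bool" where
  "proof_in R L (Infer r s ds) =
    (R r (map concl ds) s \<and> over L s \<and> (\<forall>d\<in>set ds. proof_in R L d))"

definition nd_proof :: "('f \<times> nat) set \<Rightarrow> ('p \<times> nat) set \<Rightarrow> ('f, 'p) deriv \<Rightarrow> bool" where
  "nd_proof F P = proof_in nd_rule (nd_fm F P)"

definition pa_proof :: "('f \<times> nat) set \<Rightarrow> ('p \<times> nat) set \<Rightarrow> ('f, 'p) deriv \<Rightarrow> bool" where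
  "pa_proof F P = proof_in pa_rule (wf_fm F P)"

fun subproofs :: "('f, 'p) deriv \<Rightarrow> ('f, 'p) deriv set" where
  "subproofs (Infer r s ds) = insert (Infer r s ds) (\<Union>d\<in>set ds. subproofs d)"

text \<open>The major premise is the first one.\<close>

fun specific_cut :: "('f, 'p) deriv \<Rightarrow> bool" where
  "specific_cut (Infer r s []) = False"
| "specific_cut (Infer r s (d # ds)) =
    ((r, last_rule d) \<in> {(AndE1, AndI), (AndE2, AndI), (OrE, OrI1), (OrE, OrI2), (ImpE, ImpI),
      (ForallE, ForallI), (ExistsE, ExistsI)})"

definition specific_cut_free :: "('f, 'p) deriv \<Rightarrow> bool" where
  "specific_cut_free d \<longleftrightarrow> (\<forall>e\<in>subproofs d. \<not> specific_cut e)"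

text \<open>The freeze function is meant for \<open>Box\<close>-free propositions; its value on \<open>Box A\<close> is a dummy.\<close>

primrec freeze :: "('f, 'p) fm \<Rightarrow> ('f, 'p) fm" where
  "freeze (Pred p ts) = Pred p ts"
| "freeze Top = Top"
| "freeze Bot = Bot"
| "freeze (And A B) = And (freeze A) (freeze B)"
| "freeze (Or A B) = Or (freeze A) (freeze B)"
| "freeze (Imp A B) = (if atomic A then Imp A (freeze B) else Imp (Box A) (freeze B))"
| "freeze (Forall A) = Forall (freeze A)"
| "freeze (Exists A) = Exists (freeze A)"
| "freeze (Box A) = Box A"

primrec unfreeze :: "('f, 'p) fm \<Rightarrow> ('f, 'p) fm" where
  "unfreeze (Pred p ts) = Pred p ts"
| "unfreeze Top = Top"
| "unfreeze Bot = Bot"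
| "unfreeze (And A B) = And (unfreeze A) (unfreeze B)"
| "unfreeze (Or A B) = Or (unfreeze A) (unfreeze B)"
| "unfreeze (Imp A B) = Imp (unfreeze A) (unfreeze B)"
| "unfreeze (Forall A) = Forall (unfreeze A)"
| "unfreeze (Exists A) = Exists (unfreeze A)"
| "unfreeze (Box A) = unfreeze A"

end

theory Submission
  imports Defs
begin

text \<open>In an atomic context a specific-cut-free proof ends with an introduction rule: otherwise its
  major premise, which has the same context, would by induction end with an introduction rule, and
  since it is not atomic it is not an axiom, so the proof would be a specific cut. Hence the proof
  can be replayed in the pseudo-automaton from the conclusion upwards until it introduces an
  implication whose hypothesis is not atomic; there the delay rule applies, and unfreezing the
  delayed sequent gives back the sequent proved by the remaining part of the proof.\<close>

lemma unfreeze_box_free: "box_free A \<Longrightarrow> unfreeze A = A"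
  by (induction A) auto

lemma unfreeze_freeze: "box_free A \<Longrightarrow> unfreeze (freeze A) = A"
  by (induction A) (auto simp: unfreeze_box_free)

lemma wf_fm_freeze: "wf_fm F P A \<Longrightarrow> wf_fm F P (freeze A)"
  by (induction A) auto

lemma freeze_atomic: "atomic A \<Longrightarrow> freeze A = A"
  by (cases A) auto

lemma atomic_subst_fm: "atomic (subst_fm \<sigma> A) \<longleftrightarrow> atomic A"
  by (cases A) auto

text \<open>Freezing depends only on which hypotheses of implications are atomic, and substitution
  preserves this.\<close>

lemma freeze_subst_fm: "freeze (subst_fm \<sigma> A) = subst_fm \<sigma> (freeze A)"
  by (induction A arbitrary: \<sigma>) (auto simp: atomic_subst_fm)

lemma specific_cut_free_Infer:
  "specific_cut_free (Infer r s ds) \<longleftrightarrow>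
    \<not> specific_cut (Infer r s ds) \<and> (\<forall>d\<in>set ds. specific_cut_free d)"
  by (auto simp: specific_cut_free_def)

lemma nd_proof_Infer:
  "nd_proof F P (Infer r s ds) \<longleftrightarrow>
    nd_rule r (map concl ds) s \<and> over (nd_fm F P) s \<and> (\<forall>d\<in>set ds. nd_proof F P d)"
  by (auto simp: nd_proof_def)

lemma specific_cut_free_ends_with_intro:
  assumes "nd_proof F P (Infer r (\<Gamma> \<turnstile> A) ds)"
    and "specific_cut_free (Infer r (\<Gamma> \<turnstile> A) ds)"
    and "\<forall>B\<in>set \<Gamma>. atomic B"
  shows "intro_rule r (map concl ds) (\<Gamma> \<turnstile> A)"
  using assms
\<comment> \<open>The context stays fixed because only major premises are visited; the minor
  premises of \<open>OrE\<close> and \<open>ExistsE\<close> may have non-atomic contexts.\<close>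
proof (induction "Infer r (\<Gamma> \<turnstile> A) ds" arbitrary: r A ds rule: deriv.induct)
  case (Infer r ds A)
  show ?case
  proof (rule ccontr)
    assume "\<not> ?case"
    then have elim: "elim_rule r (map concl ds) (\<Gamma> \<turnstile> A)"
      using Infer.prems(1) by (simp add: nd_proof_Infer nd_rule_def)
    then obtain d ds' where ds: "ds = d # ds'"
      by (cases ds) (auto elim: elim_rule.cases)
    obtain r' s' es where d: "d = Infer r' s' es"
      by (cases d)
    from elim obtain C where C: "s' = (\<Gamma> \<turnstile> C)" "\<not> atomic C"
      unfolding ds d by cases auto
    have "intro_rule r' (map concl es) (\<Gamma> \<turnstile> C)"
      using Infer.hyps[of r' C es] Infer.prems
      by (simp add: ds d C nd_proof_Infer[of _ _ r] specific_cut_free_Infer[of r])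
    moreover have "\<not> specific_cut (Infer r (\<Gamma> \<turnstile> A) ds)"
      using Infer.prems(2) by (simp add: specific_cut_free_Infer)
    \<comment> \<open>\<open>Axiom\<close> is excluded because \<open>C\<close> is not atomic.
      \<open>Bot\<close> has no other introduction, which settles \<open>BotE\<close>; for every
      other elimination the introduction of \<open>C\<close> makes a specific cut.\<close>
    ultimately show False
      using elim C Infer.prems(3) unfolding ds d
      by (auto elim!: elim_rule.cases elim: intro_rule.cases)
  qed
qed

text \<open>Stated for one sequent, so that the goal becomes closure under the introduction rules,
  with the delay rule as a base case.\<close>

definition delayed_provable ::
  "('f \<times> nat) set \<Rightarrow> ('p \<times> nat) set \<Rightarrow> ('f, 'p) sequent \<Rightarrow> bool" where
  "delayed_provable F P s \<longleftrightarrow>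
    (\<exists>d. pa_proof F P d \<and> concl d = s \<and>
      (\<forall>\<Delta> B. Infer Delay (\<Delta> \<turnstile> B) [] \<in> subproofs d \<longrightarrow>
        (\<exists>e. nd_proof F P e \<and> concl e = (map unfreeze \<Delta> \<turnstile> unfreeze B))))"

lemma delayed_provable_intro:
  assumes "intro_rule r ps s" and "over (wf_fm F P) s" and "\<forall>p\<in>set ps. delayed_provable F P p"
  shows "delayed_provable F P s"
proof -
  obtain g where g: "\<And>p. p \<in> set ps \<Longrightarrow> pa_proof F P (g p) \<and> concl (g p) = p \<and>
      (\<forall>\<Delta> B. Infer Delay (\<Delta> \<turnstile> B) [] \<in> subproofs (g p) \<longrightarrow>
        (\<exists>e. nd_proof F P e \<and> concl e = (map unfreeze \<Delta> \<turnstile> unfreeze B)))"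
    using assms(3) unfolding delayed_provable_def by metis
  have "map concl (map g ps) = ps"
    using g by (simp add: map_idI)
  \<comment> \<open>The new root is thus not a delay leaf, so all delay leaves come from the
    premises.\<close>
  moreover have "r \<noteq> Delay"
    using assms(1) by cases auto
  ultimately show ?thesis
    unfolding delayed_provable_def using assms(1,2) g
    by (intro exI[of _ "Infer r s (map g ps)"]) (auto simp: pa_proof_def pa_rule_def)
qed

lemma delayed_provable_delay:
  assumes "Box C \<in> set \<Delta>" and "over (wf_fm F P) (\<Delta> \<turnstile> B)"
    and "nd_proof F P e" and "concl e = (map unfreeze \<Delta> \<turnstile> unfreeze B)"
  shows "delayed_provable F P (\<Delta> \<turnstile> B)"
  unfolding delayed_provable_def using assms
  by (intro exI[of _ "Infer Delay (\<Delta> \<turnstile> B) []"])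
    (auto simp: pa_proof_def pa_rule_def intro: delay_rule.intros)

text \<open>The context varies in the induction, since \<open>ImpI\<close> and
  \<open>ForallI\<close> change it.\<close>

lemma delayed_provable_freeze:
  assumes "nd_proof F P d" and "specific_cut_free d"
    and "concl d = (\<Gamma> \<turnstile> A)" and "\<forall>B\<in>set \<Gamma>. atomic B"
  shows "delayed_provable F P (\<Gamma> \<turnstile> freeze A)"
  using assms
proof (induction d arbitrary: \<Gamma> A)
  case (Infer r s ds)
  have s: "s = (\<Gamma> \<turnstile> A)"
    using Infer.prems(3) by simp
  have IH: "delayed_provable F P (\<Delta> \<turnstile> freeze B)"
    if "(\<Delta> \<turnstile> B) \<in> set (map concl ds)" "\<forall>C\<in>set \<Delta>. atomic C" for \<Delta> B
    using that Infer by (auto simp: nd_proof_Infer specific_cut_free_Infer)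
  have nd: "over (nd_fm F P) (\<Gamma> \<turnstile> A)"
    using Infer.prems(1) by (simp add: s nd_proof_Infer)
  then have wf: "over (wf_fm F P) (\<Gamma> \<turnstile> freeze A)"
    by (auto simp: nd_fm_def wf_fm_freeze)
  note intro = delayed_provable_intro[OF _ wf]
  have "intro_rule r (map concl ds) (\<Gamma> \<turnstile> A)"
    using Infer.prems s specific_cut_free_ends_with_intro by metis
  then show ?case
  proof cases
    case 1
    then show ?thesis
      \<comment> \<open>Here \<open>A\<close> belongs to the context, so it is atomic and freezing
        fixes it.\<close>
      using Infer.prems(4)
      by (intro intro[of Axiom "[]"]) (auto simp: freeze_atomic intro: intro_rule.intros)
  next
    case 2
    then show ?thesis
      by (intro intro[of TopI "[]"]) (auto intro: intro_rule.intros)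
  next
    case (3 B C)
    then show ?thesis
      using IH Infer.prems(4)
      by (intro intro[of AndI "[\<Gamma> \<turnstile> freeze B, \<Gamma> \<turnstile> freeze C]"]) (auto intro: intro_rule.intros)
  next
    case (4 B C)
    then show ?thesis
      using IH Infer.prems(4)
      by (intro intro[of OrI1 "[\<Gamma> \<turnstile> freeze B]"]) (auto intro: intro_rule.intros)
  next
    case (5 C B)
    then show ?thesis
      using IH Infer.prems(4)
      by (intro intro[of OrI2 "[\<Gamma> \<turnstile> freeze C]"]) (auto intro: intro_rule.intros)
  next
    case (6 B C)
    show ?thesis
    \<comment> \<open>An atomic \<open>B\<close> keeps the context atomic, so the induction
      hypothesis applies. Otherwise \<open>Box B\<close> enters the context and the search stops
      there.\<close>
    proof (cases "atomic B")
      case True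
      then show ?thesis
        using IH Infer.prems(4) 6
        by (intro intro[of ImpI "[B # \<Gamma> \<turnstile> freeze C]"]) (auto intro: intro_rule.intros)
    next
      case False
      \<comment> \<open>The witness for the delayed leaf is the given proof of the premise of
        \<open>ImpI\<close>.\<close>
      obtain e where e: "nd_proof F P e" "concl e = (B # \<Gamma> \<turnstile> C)"
        using Infer.prems(1) 6 by (auto simp: nd_proof_Infer)
      have "map unfreeze (Box B # \<Gamma>) = B # \<Gamma>" "unfreeze (freeze C) = C"
        using nd 6 by (auto simp: nd_fm_def unfreeze_box_free unfreeze_freeze intro: map_idI)
      then have "delayed_provable F P (Box B # \<Gamma> \<turnstile> freeze C)"
        using e wf 6 False by (intro delayed_provable_delay[of B _ _ _ _ e]) auto
      then show ?thesis
        using 6 False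
        by (intro intro[of ImpI "[Box B # \<Gamma> \<turnstile> freeze C]"]) (auto intro: intro_rule.intros)
    qed
  next
    case (7 B)
    then show ?thesis
      using IH Infer.prems(4)
      by (intro intro[of ForallI "[map shift \<Gamma> \<turnstile> freeze B]"])
        (auto simp: shift_def atomic_subst_fm intro: intro_rule.intros[unfolded shift_def])
  next
    case (8 t B)
    \<comment> \<open>The premise proves an instance of \<open>B\<close>; freezing it is the same as
      instantiating \<open>freeze B\<close>.\<close>
    then show ?thesis
      using IH[of \<Gamma> "inst t B"] Infer.prems(4)
      by (intro intro[of ExistsI "[\<Gamma> \<turnstile> inst t (freeze B)]"])
        (auto simp: inst_def freeze_subst_fm intro: intro_rule.intros[unfolded inst_def])
  qed
qed

theorem theorem3:
  fixes F :: "('f \<times> nat) set" and P :: "('p \<times> nat) set"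
    and \<Gamma> :: "('f, 'p) fm list" and A :: "('f, 'p) fm"
  assumes "over (nd_fm F P) (\<Gamma> \<turnstile> A)"
    and "\<forall>B\<in>set \<Gamma>. atomic B"
    and "\<exists>d. nd_proof F P d \<and> concl d = (\<Gamma> \<turnstile> A) \<and> specific_cut_free d"
  shows "\<exists>d. pa_proof F P d \<and> concl d = (\<Gamma> \<turnstile> freeze A) \<and>
    (\<forall>\<Delta> B. Infer Delay (\<Delta> \<turnstile> B) [] \<in> subproofs d \<longrightarrow>
      (\<exists>e. nd_proof F P e \<and> concl e = (map unfreeze \<Delta> \<turnstile> unfreeze B)))"
  using assms(2,3) delayed_provable_freeze unfolding delayed_provable_def by blast

end
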